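(* Let $s:\mathbb{Z}^2\to S^3\subset\mathbb{R}P^4$ be a discrete Königs net in the Möbius quadric, let $\mathfrak q\in\mathbb{R}^{4,1}\setminus\{0\}$, and let $\mathfrak s:\mathbb{Z}^2\to\mathfrak Q^3$ be the affine projection of $s$ determined by $\mathfrak q$, i.e. $s_i=\mathbb{R}\,\mathfrak s_i$ with $(\mathfrak s_i,\mathfrak s_i)=0$ and $(\mathfrak s_i,\mathfrak q)=1$ for all $i\in\mathbb{Z}^2$. Then $\mathfrak s$ is a constant mean curvature net in the quadric $\mathfrak Q^3$ of constant curvature, i.e. there are a Gauss map $\mathfrak n$ of $\mathfrak s$ and a constant $H\in\mathbb{R}$ such that $A(\mathfrak n,\mathfrak s)=-H\,A(\mathfrak s,\mathfrak s)$ on every face, if and only if a Königs dual $\mathfrak s^\ast$ of $\mathfrak s$ takes values in a concentric quadric $\mathfrak Q^3_{r,t}$, for some $r,t\in\mathbb{R}$. Moreover, the Gauss map $\mathfrak n$ of $\mathfrak s$ is obtained (up to normalization to unit length) by projecting the vector field joining $\mathfrak s$ and its dual $\mathfrak s^\ast$ onto the tangent bundle of $\mathfrak Q^3$, with tangent spaces $T_{\mathfrak s_i}\mathfrak Q^3=\{\mathfrak s_i,\mathfrak q\}^\perp$.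
   Context: $\mathbb{R}^{4,1}$ is $\mathbb{R}^5$ with a Minkowski inner product $(\cdot,\cdot)$ of signature $(4,1)$, serving as space of homogeneous coordinates of $\mathbb{R}P^4$. Put $\mathcal L^4_t=\{y\in\mathbb{R}^{4,1}: (y,y)=t\}$ and $\mathcal L^4=\mathcal L^4_0$; the Möbius quadric is $S^3=P(\mathcal L^4)\subset\mathbb{R}P^4$. For fixed $\mathfrak q\neq0$ put $\mathfrak E^4_r=\{y\in\mathbb{R}^{4,1}:(y,\mathfrak q)=r\}$ and $\mathfrak E^4=\mathfrak E^4_1$. The quadric $\mathfrak Q^3=\mathcal L^4\cap\mathfrak E^4$ has constant sectional curvature $\kappa=-(\mathfrak q,\mathfrak q)$. Its concentric quadrics are $\mathfrak Q^3_{r,t}=\mathcal L^4_t\cap\mathfrak E^4_r$; in particular $\mathfrak Q^3=\mathfrak Q^3_{1,0}$. A discrete conjugate net is a map on $\mathbb{Z}^2$ such that the four vertices of each elementary quadrilateral (face) $(ijkl)$, with vertices listed cyclically, are coplanar. A discrete Königs net is a discrete conjugate net such that at each vertex the four intersection points of the diagonals of the four incident faces are coplanar. For a vector valued map $g$ on $\mathbb{Z}^2$ write $dg_{ij}=g_j-g_i$ for edges $(ij)$ and $\delta g_{ik}=g_k-g_i$ for diagonals. Two conjugate nets $\mathfrak s,\mathfrak s^\ast$, in the same or in parallel affine spaces, are Königs dual if they are edge-parallel and have parallel non-corresponding diagonals: on every edge $d\mathfrak s^\ast_{ij}=c_{ij}\,d\mathfrak s_{ij}$ with $c_{ij}\in\mathbb{R}\setminus\{0\}$,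 and on every face $\delta\mathfrak s^\ast_{ik}\wedge\delta\mathfrak s_{jl}=0$ and $\delta\mathfrak s_{ik}\wedge\delta\mathfrak s^\ast_{jl}=0$. The mixed area of two edge-parallel nets on a face is $A(\mathfrak s,\mathfrak n)_{ijkl}=\frac14\{\delta\mathfrak s_{ik}\wedge\delta\mathfrak n_{jl}+\delta\mathfrak n_{ik}\wedge\delta\mathfrak s_{jl}\}\in\Lambda^2\mathbb{R}^{4,1}$. A Gauss map of $\mathfrak s:\mathbb{Z}^2\to\mathfrak Q^3$ is a map $\mathfrak n:\mathbb{Z}^2\to\mathbb{R}^{4,1}$ with $(\mathfrak n,\mathfrak n)\equiv1$, $\mathfrak n_i\in T_{\mathfrak s_i}\mathfrak Q^3=\{\mathfrak s_i,\mathfrak q\}^\perp$ at all vertices, and $d\mathfrak n_{ij}+k_{ij}\,d\mathfrak s_{ij}=0$ on every edge for some $k_{ij}\in\mathbb{R}$. The mean curvature $H$ of $(\mathfrak s,\mathfrak n)$ is the function on faces defined by $A(\mathfrak n,\mathfrak s)=-H\,A(\mathfrak s,\mathfrak s)$.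
   Formalization: Added: A(s,s) is nonzero on some face (else H is undefined); "cmc implies dual" only for s not in a 2-sphere (else false: stereographic image of Z^2), and only Gauss maps n with n+ks nonconstant for all k are claimed to come from a dual. *)

theory Defs
  imports "HOL-Analysis.Analysis"
begin

section \<open>Minkowski space and the quadrics of constant curvature\<close>

definition mink :: "real ^ 5 \<Rightarrow> real ^ 5 \<Rightarrow> real" where
  "mink x y = x $ 1 * y $ 1 + x $ 2 * y $ 2 + x $ 3 * y $ 3 + x $ 4 * y $ 4 - x $ 5 * y $ 5"

text \<open>\<open>concentric_quadric q r t\<close> is the intersection of \<open>{y. (y,y) = t}\<close> and
  \<open>{y. (y,q) = r}\<close>; the quadric of constant curvature \<open>- (q,q)\<close> itself is the case
  \<open>r = 1\<close>, \<open>t = 0\<close>.\<close>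

definition concentric_quadric :: "real ^ 5 \<Rightarrow> real \<Rightarrow> real \<Rightarrow> (real ^ 5) set" where
  "concentric_quadric q r t = {y. mink y y = t \<and> mink y q = r}"

definition tangent_space :: "real ^ 5 \<Rightarrow> real ^ 5 \<Rightarrow> (real ^ 5) set" where
  "tangent_space q x = {y. mink y x = 0 \<and> mink y q = 0}"

text \<open>Orthogonal projection with respect to the Minkowski product. It is well defined when the
  product is nondegenerate on \<open>W\<close>, as it is on the tangent spaces
  \<open>tangent_space q x\<close> with \<open>(x,x) = 0\<close> and \<open>(x,q) = 1\<close>.\<close>

definition mink_proj :: "(real ^ 5) set \<Rightarrow> real ^ 5 \<Rightarrow> real ^ 5" where
  "mink_proj W v = (THE w. w \<in> W \<and> (\<forall>u\<in>W. mink (v - w) u = 0))"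

definition mink_normalize :: "real ^ 5 \<Rightarrow> real ^ 5" where
  "mink_normalize v = (1 / sqrt (mink v v)) *\<^sub>R v"

text \<open>A bivector is encoded as a skew-symmetric matrix: \<open>v\<close> wedge \<open>w\<close> is
  \<open>v w\<^sup>T - w v\<^sup>T\<close>.\<close>

definition wedge :: "real ^ 5 \<Rightarrow> real ^ 5 \<Rightarrow> real ^ 5 ^ 5" where
  "wedge v w = (\<chi> a b. v $ a * w $ b - w $ a * v $ b)"


section \<open>Nets on the square lattice\<close>

type_synonym vertex = "int \<times> int"

definition is_edge :: "vertex \<Rightarrow> vertex \<Rightarrow> bool" where
  "is_edge i j \<longleftrightarrow> (\<exists>m n. i = (m, n) \<and> (j = (m + 1, n) \<or> j = (m, n + 1)))"

definition is_face :: "vertex \<Rightarrow> vertex \<Rightarrow> vertex \<Rightarrow> vertex \<Rightarrow> bool" where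
  "is_face i j k l \<longleftrightarrow>
     (\<exists>m n. i = (m, n) \<and> j = (m + 1, n) \<and> k = (m + 1, n + 1) \<and> l = (m, n + 1))"

text \<open>Used both for edges (\<open>d\<close>) and for diagonals (\<open>\<delta>\<close>).\<close>

definition diff :: "(vertex \<Rightarrow> real ^ 5) \<Rightarrow> vertex \<Rightarrow> vertex \<Rightarrow> real ^ 5" where
  "diff g i j = g j - g i"


section \<open>Koenigs nets in projective space\<close>

text \<open>Points of the projective space of \<open>real ^ 5\<close> are represented by one-dimensional
  subspaces.\<close>

definition proj_points :: "(real ^ 5) set set" where
  "proj_points = {span {y} |y. y \<noteq> 0}"

definition moebius_quadric :: "(real ^ 5) set set" where
  "moebius_quadric = {span {y} |y. y \<noteq> 0 \<and> mink y y = 0}"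

definition proj_coplanar :: "(real ^ 5) set set \<Rightarrow> bool" where
  "proj_coplanar P \<longleftrightarrow> (\<exists>W. subspace W \<and> dim W = 3 \<and> (\<forall>p\<in>P. p \<subseteq> W))"

definition proj_conjugate_net :: "(vertex \<Rightarrow> (real ^ 5) set) \<Rightarrow> bool" where
  "proj_conjugate_net S \<longleftrightarrow>
     (\<forall>i. S i \<in> proj_points) \<and>
     (\<forall>i j k l. is_face i j k l \<longrightarrow> proj_coplanar {S i, S j, S k, S l})"

definition diag_meet ::
    "(vertex \<Rightarrow> (real ^ 5) set) \<Rightarrow> vertex \<Rightarrow> vertex \<Rightarrow> vertex \<Rightarrow> vertex \<Rightarrow> (real ^ 5) set" where
  "diag_meet S i j k l = span (S i \<union> S k) \<inter> span (S j \<union> S l)"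

text \<open>The second conjunct says that the two diagonals of a face are lines meeting in a single
  point; without it the intersection points of the diagonals would not be defined.\<close>

definition koenigs_net :: "(vertex \<Rightarrow> (real ^ 5) set) \<Rightarrow> bool" where
  "koenigs_net S \<longleftrightarrow>
     proj_conjugate_net S \<and>
     (\<forall>i j k l. is_face i j k l \<longrightarrow>
        S i \<noteq> S k \<and> S j \<noteq> S l \<and> diag_meet S i j k l \<in> proj_points) \<and>
     (\<forall>p. proj_coplanar {diag_meet S i j k l |i j k l. is_face i j k l \<and> p \<in> {i, j, k, l}})"


section \<open>Koenigs duality, Gauss maps and constant mean curvature\<close>

definition conjugate_net :: "(vertex \<Rightarrow> real ^ 5) \<Rightarrow> bool" where
  "conjugate_net s \<longleftrightarrow> (\<forall>i j k l. is_face i j k l \<longrightarrow> coplanar {s i, s j, s k, s l})"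

text \<open>Since the edges are parallel with nonzero factors, the affine hulls of the two nets are
  automatically parallel.\<close>

definition koenigs_dual :: "(vertex \<Rightarrow> real ^ 5) \<Rightarrow> (vertex \<Rightarrow> real ^ 5) \<Rightarrow> bool" where
  "koenigs_dual s s' \<longleftrightarrow>
     conjugate_net s \<and> conjugate_net s' \<and>
     (\<forall>i j. is_edge i j \<longrightarrow> (\<exists>c. c \<noteq> 0 \<and> diff s' i j = c *\<^sub>R diff s i j)) \<and>
     (\<forall>i j k l. is_face i j k l \<longrightarrow>
        wedge (diff s' i k) (diff s j l) = 0 \<and> wedge (diff s i k) (diff s' j l) = 0)"

definition mixed_area ::
    "(vertex \<Rightarrow> real ^ 5) \<Rightarrow> (vertex \<Rightarrow> real ^ 5) \<Rightarrow>
     vertex \<Rightarrow> vertex \<Rightarrow> vertex \<Rightarrow> vertex \<Rightarrow> real ^ 5 ^ 5" where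
  "mixed_area s n i j k l =
     (1 / 4) *\<^sub>R (wedge (diff s i k) (diff n j l) + wedge (diff n i k) (diff s j l))"

definition gauss_map ::
    "real ^ 5 \<Rightarrow> (vertex \<Rightarrow> real ^ 5) \<Rightarrow> (vertex \<Rightarrow> real ^ 5) \<Rightarrow> bool" where
  "gauss_map q s n \<longleftrightarrow>
     (\<forall>i. mink (n i) (n i) = 1 \<and> n i \<in> tangent_space q (s i)) \<and>
     (\<forall>i j. is_edge i j \<longrightarrow> (\<exists>k. diff n i j + k *\<^sub>R diff s i j = 0))"

definition mean_curvature_const ::
    "(vertex \<Rightarrow> real ^ 5) \<Rightarrow> (vertex \<Rightarrow> real ^ 5) \<Rightarrow> real \<Rightarrow> bool" where
  "mean_curvature_const s n H \<longleftrightarrow>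
     (\<forall>i j k l. is_face i j k l \<longrightarrow> mixed_area n s i j k l = - H *\<^sub>R mixed_area s s i j k l)"

definition cmc_net :: "real ^ 5 \<Rightarrow> (vertex \<Rightarrow> real ^ 5) \<Rightarrow> bool" where
  "cmc_net q s \<longleftrightarrow> (\<exists>n H. gauss_map q s n \<and> mean_curvature_const s n H)"

definition koenigs_dual_in_concentric ::
    "real ^ 5 \<Rightarrow> (vertex \<Rightarrow> real ^ 5) \<Rightarrow> (vertex \<Rightarrow> real ^ 5) \<Rightarrow> bool" where
  "koenigs_dual_in_concentric q s s' \<longleftrightarrow>
     koenigs_dual s s' \<and> (\<exists>r t. \<forall>i. s' i \<in> concentric_quadric q r t)"

text \<open>The normalized tangential projection of the vector field joining \<open>s\<close> and \<open>s'\<close>.\<close>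

definition joining_normal ::
    "real ^ 5 \<Rightarrow> (vertex \<Rightarrow> real ^ 5) \<Rightarrow> (vertex \<Rightarrow> real ^ 5) \<Rightarrow> vertex \<Rightarrow> real ^ 5" where
  "joining_normal q s s' i = mink_normalize (mink_proj (tangent_space q (s i)) (s' i - s i))"

text \<open>The pair is totally umbilic if all edge curvatures agree, that is, if \<open>n + k s\<close> is a
  constant vector for some \<open>k\<close>. Then the mean curvature is \<open>k\<close>, but the parallel
  net \<open>n + k s\<close> is not a Koenigs dual because its edges vanish.\<close>

definition totally_umbilic :: "(vertex \<Rightarrow> real ^ 5) \<Rightarrow> (vertex \<Rightarrow> real ^ 5) \<Rightarrow> bool" where
  "totally_umbilic s n \<longleftrightarrow> (\<exists>k. \<forall>i j. is_edge i j \<longrightarrow> diff n i j + k *\<^sub>R diff s i j = 0)"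

text \<open>A spacelike \<open>v\<close> represents a 2-sphere in the Moebius quadric. The nets in a 2-sphere
  are precisely those with a totally umbilic Gauss map.\<close>

definition spherical_net :: "(vertex \<Rightarrow> real ^ 5) \<Rightarrow> bool" where
  "spherical_net s \<longleftrightarrow> (\<exists>v. mink v v > 0 \<and> (\<forall>i. mink (s i) v = 0))"

end

theory Submission
  imports Defs
begin

text \<open>If \<open>s'\<close> is a dual of \<open>s\<close> with constant \<open>(s',s')\<close> and \<open>r = (s',q)\<close>, then \<open>b = (s',s)\<close> is
  constant as well, because \<open>ds'\<close> and \<open>ds\<close> are parallel and orthogonal to the sums of the end
  points of the edges of both nets. Hence the tangential projection of \<open>s' - s\<close> is
  \<open>s' - (r - b (q,q)) s - b q\<close>, which has constant length and is edge-parallel to \<open>s\<close>, and the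
  vanishing of the mixed area of \<open>s'\<close> and \<open>s\<close> yields constant mean curvature.
  Conversely \<open>s' = n + H s\<close> has vanishing mixed area with \<open>s\<close>. As the quadric contains no three
  collinear points, one vanishing edge of \<open>s'\<close> collapses the faces containing it, hence all of
  \<open>s'\<close>; so \<open>s'\<close> is a dual net unless \<open>n\<close> is totally umbilic.\<close>

section \<open>Minkowski geometry\<close>

lemma mink_commute: "mink x y = mink y x"
  by (simp add: mink_def)

lemma mink_add_left: "mink (x + y) z = mink x z + mink y z"
  and mink_add_right: "mink z (x + y) = mink z x + mink z y"
  and mink_diff_left: "mink (x - y) z = mink x z - mink y z"
  and mink_diff_right: "mink z (x - y) = mink z x - mink z y"
  and mink_scaleR_left: "mink (c *\<^sub>R x) z = c * mink x z"
  and mink_scaleR_right: "mink z (c *\<^sub>R x) = c * mink z x"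
  by (simp_all add: mink_def algebra_simps)

lemma mink_zero_left [simp]: "mink 0 x = 0"
  by (simp add: mink_def)

lemmas mink_simps = mink_add_left mink_add_right mink_diff_left mink_diff_right
  mink_scaleR_left mink_scaleR_right

lemma forall_5: "(\<forall>i::5. P i) \<longleftrightarrow> P 1 \<and> P 2 \<and> P 3 \<and> P 4 \<and> P 5"
proof -
  have "i = 1 \<or> i = 2 \<or> i = 3 \<or> i = 4 \<or> i = 5" for i :: 5
  proof (cases i)
    case (of_int z)
    hence "z = 0 \<or> z = 1 \<or> z = 2 \<or> z = 3 \<or> z = 4" by auto
    thus ?thesis using of_int by auto
  qed
  thus ?thesis by metis
qed

text \<open>As \<open>x\<close> is lightlike and \<open>(x,q) = 1\<close>, its timelike coordinate
  is nonzero, so subtracting a multiple of \<open>x\<close> removes that of \<open>y\<close>. This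
  preserves \<open>(y,y)\<close>, which thus is a sum of squares; if it vanishes, \<open>y\<close>
  is a multiple of \<open>x\<close>, and \<open>(y,q) = 0\<close> makes the factor zero.\<close>

lemma mink_tangent_pos:
  assumes "mink x x = 0" "mink x q = 1" "y \<in> tangent_space q x"
  shows "mink y y \<ge> 0" and "mink y y = 0 \<Longrightarrow> y = 0"
proof -
  have x5: "x $ 5 \<noteq> 0"
  proof
    assume 0: "x $ 5 = 0"
    with assms(1) have "(x $ 1)\<^sup>2 + (x $ 2)\<^sup>2 + (x $ 3)\<^sup>2 + (x $ 4)\<^sup>2 = 0"
      by (simp add: mink_def power2_eq_square)
    hence "x $ 1 = 0 \<and> x $ 2 = 0 \<and> x $ 3 = 0 \<and> x $ 4 = 0"
      by (smt (verit) zero_le_power2 power_eq_0_iff)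
    with 0 assms(2) show False by (simp add: mink_def)
  qed
  define z where "z = y - (y $ 5 / x $ 5) *\<^sub>R x"
  have z5: "z $ 5 = 0" using x5 by (simp add: z_def)
  have yx: "mink y x = 0" "mink y q = 0" using assms(3) by (auto simp: tangent_space_def)
  have "mink y y = mink z z"
    using yx(1) assms(1) by (simp add: z_def mink_simps mink_commute[of x y])
  also have "\<dots> = (z $ 1)\<^sup>2 + (z $ 2)\<^sup>2 + (z $ 3)\<^sup>2 + (z $ 4)\<^sup>2"
    using z5 by (simp add: mink_def power2_eq_square)
  finally have eq: "mink y y = (z $ 1)\<^sup>2 + (z $ 2)\<^sup>2 + (z $ 3)\<^sup>2 + (z $ 4)\<^sup>2" .
  show "mink y y \<ge> 0" unfolding eq by simp
  assume "mink y y = 0"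
  hence "z $ 1 = 0 \<and> z $ 2 = 0 \<and> z $ 3 = 0 \<and> z $ 4 = 0"
    unfolding eq by (smt (verit) zero_le_power2 power_eq_0_iff)
  with z5 have "z = 0" by (simp add: vec_eq_iff forall_5)
  hence y: "y = (y $ 5 / x $ 5) *\<^sub>R x" by (simp add: z_def)
  have "mink y q = y $ 5 / x $ 5"
    by (subst y) (simp add: mink_scaleR_left assms(2))
  with yx(2) have "y $ 5 / x $ 5 = 0" by simp
  with y show "y = 0" by (metis scaleR_zero_left)
qed

text \<open>Definiteness on the tangent space makes the projection unique, so the description
  operator is evaluated by exhibiting a candidate.\<close>

lemma mink_proj_eqI:
  assumes "mink x x = 0" "mink x q = 1" "w \<in> tangent_space q x"
    and "\<And>u. u \<in> tangent_space q x \<Longrightarrow> mink (v - w) u = 0"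
  shows "mink_proj (tangent_space q x) v = w"
  unfolding mink_proj_def
proof (rule the_equality)
  show "w \<in> tangent_space q x \<and> (\<forall>u\<in>tangent_space q x. mink (v - w) u = 0)"
    using assms by blast
next
  fix w' assume w': "w' \<in> tangent_space q x \<and> (\<forall>u\<in>tangent_space q x. mink (v - w') u = 0)"
  have d: "w' - w \<in> tangent_space q x"
    using assms(3) w' by (simp add: tangent_space_def mink_simps)
  have "mink (v - w) (w' - w) = 0" "mink (v - w') (w' - w) = 0"
    using assms(4) w' d by blast+
  hence "mink (w' - w) (w' - w) = 0" by (simp add: mink_simps)
  with mink_tangent_pos(2)[OF assms(1,2) d] show "w' = w" by simp
qed

lemma mink_normalize_unit: "mink v v = 1 \<Longrightarrow> mink_normalize v = v"
  by (simp add: mink_normalize_def)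


section \<open>Bivectors\<close>

lemma wedge_scaleR_left: "wedge (c *\<^sub>R x) z = c *\<^sub>R wedge x z"
  and wedge_scaleR_right: "wedge z (c *\<^sub>R x) = c *\<^sub>R wedge z x"
  and wedge_self: "wedge x x = 0"
  and wedge_commute: "wedge x y = - wedge y x"
  by (simp_all add: wedge_def vec_eq_iff algebra_simps)

lemma wedge_zero_left [simp]: "wedge 0 x = 0"
  and wedge_zero_right [simp]: "wedge x 0 = 0"
  by (simp_all add: wedge_def vec_eq_iff)

lemma wedge_eq_0_imp_parallel:
  assumes "wedge v w = 0" "v \<noteq> 0"
  obtains c where "w = c *\<^sub>R v"
proof -
  obtain a where a: "v $ a \<noteq> 0" using assms(2) by (auto simp: vec_eq_iff)
  have "v $ a * w $ b = w $ a * v $ b" for b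
    using assms(1) by (simp add: wedge_def vec_eq_iff)
  hence "w = (w $ a / v $ a) *\<^sub>R v" using a by (simp add: vec_eq_iff field_simps)
  thus thesis by (rule that)
qed

text \<open>The two sides differ by a signed sum of wedges of corresponding edges. Hence the two
  summands of the mixed area of edge-parallel nets agree, and if their sum vanishes, so does each of
  them.\<close>

lemma edge_parallel_wedge_diagonals:
  assumes "wedge (xj - xi) (yj - yi) = 0" "wedge (xk - xj) (yk - yj) = 0"
    and "wedge (xl - xk) (yl - yk) = 0" "wedge (xi - xl) (yi - yl) = 0"
  shows "wedge (xk - xi) (yl - yj) = wedge (yk - yi) (xl - xj)"
proof -
  have "wedge (xk - xi) (yl - yj) - wedge (yk - yi) (xl - xj) =
      wedge (xk - xj) (yk - yj) - wedge (xj - xi) (yj - yi)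
      + wedge (xi - xl) (yi - yl) - wedge (xl - xk) (yl - yk)"
    by (simp add: wedge_def vec_eq_iff algebra_simps)
  with assms show ?thesis by simp
qed


section \<open>Faces inscribed in the quadric\<close>

text \<open>On a line \<open>x + c b\<close>, lightlikeness is a quadratic condition in
  \<open>c\<close>. Three distinct roots force \<open>(b,b) = (x,b) = 0\<close>, and
  \<open>(b,q) = 0\<close> since all points have the same height; so \<open>b\<close> is a null
  tangent vector, hence zero.\<close>

lemma no_three_collinear_points:
  assumes x: "x \<in> concentric_quadric q 1 0" and y: "y \<in> concentric_quadric q 1 0"
    and z: "z \<in> concentric_quadric q 1 0" and "wedge (y - x) (z - x) = 0"
  shows "x = y \<or> y = z \<or> x = z"
proof (rule ccontr)
  assume neq: "\<not> ?thesis"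
  then obtain c where c: "z - x = c *\<^sub>R (y - x)"
    using wedge_eq_0_imp_parallel[OF assms(4)] by auto
  define b where "b = y - x"
  have yb: "y = x + b" and zb: "z = x + c *\<^sub>R b"
    using c by (simp_all add: b_def algebra_simps)
  have qx: "mink x x = 0" "mink x q = 1" using x by (auto simp: concentric_quadric_def)
  have 1: "2 * mink x b + mink b b = 0" and bq: "mink b q = 0"
    using y qx by (auto simp: concentric_quadric_def yb mink_simps mink_commute[of b x])
  have 2: "c * (2 * mink x b + c * mink b b) = 0"
    using z qx by (simp add: concentric_quadric_def zb mink_simps mink_commute[of b x] algebra_simps)
  have "c \<noteq> 0" "c \<noteq> 1" using neq by (auto simp: yb zb)
  hence "2 * mink x b + c * mink b b = 0" using 2 by simp
  with 1 have "(c - 1) * mink b b = 0" by (simp only: left_diff_distrib)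
  with \<open>c \<noteq> 1\<close> have bb: "mink b b = 0" by (metis mult_eq_0_iff eq_iff_diff_eq_0)
  with 1 bq have "b \<in> tangent_space q x" by (simp add: tangent_space_def mink_commute[of b x])
  from mink_tangent_pos(2)[OF qx this bb] neq show False by (simp add: yb)
qed

text \<open>Adjacent vertices of the face may coincide, so collinearity has to be exploited twice.
  If the edge from \<open>yj\<close> to \<open>yk\<close> survived, then \<open>xj\<close>,
  \<open>xk\<close>, \<open>xl\<close> would be collinear, leaving only
  \<open>xk = xl\<close>.\<close>

lemma collapsed_edge_next:
  assumes quadric: "xi \<in> concentric_quadric q 1 0" "xj \<in> concentric_quadric q 1 0"
      "xk \<in> concentric_quadric q 1 0" "xl \<in> concentric_quadric q 1 0"
    and dist: "xi \<noteq> xk" "xj \<noteq> xl" "\<not> (xi = xj \<and> xk = xl)"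
    and jk: "yk - yj = b *\<^sub>R (xk - xj)" and kl: "yl - yk = c *\<^sub>R (xl - xk)"
    and li: "yi - yl = d *\<^sub>R (xi - xl)"
    and wedge: "wedge (yk - yi) (xl - xj) = 0" and "yi = yj"
  shows "yj = yk"
proof (rule ccontr)
  assume neq: "yj \<noteq> yk"
  hence b: "b \<noteq> 0" "xj \<noteq> xk" using jk by auto
  have "wedge (xk - xj) (xl - xj) = 0"
    using wedge jk b \<open>yi = yj\<close> by (simp add: wedge_scaleR_left)
  with no_three_collinear_points[OF quadric(2,3,4)] b dist have kl': "xk = xl" by blast
  \<comment> \<open>Now two edges of the \<open>y\<close> face vanish, so the other two are opposite
    vectors. This makes \<open>xi\<close>, \<open>xj\<close>, \<open>xk\<close> collinear, and every
    coincidence among them is excluded.\<close>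
  with kl have "yl = yk" by simp
  with jk li \<open>yi = yj\<close> kl' have "b *\<^sub>R (xj - xk) = d *\<^sub>R (xi - xk)"
    by (metis minus_diff_eq scaleR_minus_right)
  hence "b *\<^sub>R wedge (xj - xk) (xi - xk) = 0"
    by (metis wedge_scaleR_left wedge_self scaleR_zero_right)
  hence "wedge (xj - xk) (xi - xk) = 0" using b by simp
  with no_three_collinear_points[OF quadric(3,2,1)] b dist kl' show False by blast
qed

lemma collapsed_edge_collapses_face:
  assumes quadric: "xi \<in> concentric_quadric q 1 0" "xj \<in> concentric_quadric q 1 0"
      "xk \<in> concentric_quadric q 1 0" "xl \<in> concentric_quadric q 1 0"
    and dist: "xi \<noteq> xk" "xj \<noteq> xl" "\<not> (xi = xj \<and> xk = xl)"
    and ij: "yj - yi = a *\<^sub>R (xj - xi)" and jk: "yk - yj = b *\<^sub>R (xk - xj)"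
    and kl: "yl - yk = c *\<^sub>R (xl - xk)" and li: "yi - yl = d *\<^sub>R (xi - xl)"
    and wedge: "wedge (yk - yi) (xl - xj) = 0" "wedge (xk - xi) (yl - yj) = 0"
    and "yi = yj"
  shows "yj = yk \<and> yk = yl"
proof -
  have "yj = yk"
    using collapsed_edge_next[OF quadric dist jk kl li wedge(1) \<open>yi = yj\<close>] .
  \<comment> \<open>The same argument applies to the face traversed in the opposite sense, starting
    from the same collapsed edge.\<close>
  moreover have "yi = yl"
  proof (rule collapsed_edge_next[OF quadric(2,1,4,3) dist(2,1)])
    show "\<not> (xj = xi \<and> xl = xk)" using dist(3) by auto
    show "yl - yi = d *\<^sub>R (xl - xi)" "yk - yl = c *\<^sub>R (xk - xl)" "yj - yk = b *\<^sub>R (xj - xk)"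
      using li kl jk by (simp_all add: algebra_simps)
    show "wedge (yl - yj) (xk - xi) = 0" using wedge(2) wedge_commute[of "yl - yj" "xk - xi"] by simp
  qed (use \<open>yi = yj\<close> in simp)
  ultimately show ?thesis using \<open>yi = yj\<close> by simp
qed


section \<open>Nets on the square lattice\<close>

lemma is_face_edges:
  assumes "is_face i j k l"
  shows "is_edge i j" "is_edge j k" "is_edge l k" "is_edge i l"
  using assms by (auto simp: is_face_def is_edge_def)

lemma lattice_connected:
  fixes P :: "int \<Rightarrow> int \<Rightarrow> bool"
  assumes "P a b"
    and "\<And>m n. P m n \<longleftrightarrow> P (m + 1) n" and "\<And>m n. P m n \<longleftrightarrow> P m (n + 1)"
  shows "P m n"
proof -
  have "P m b"
    by (induction m rule: int_induct[of _ a]) (use assms(1,2) in \<open>auto, metis diff_add_cancel\<close>)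
  thus ?thesis
    by (induction n rule: int_induct[of _ b]) (use assms(3) in \<open>auto, metis diff_add_cancel\<close>)
qed

lemma constant_if_edges_constant:
  assumes "\<And>i j. is_edge i j \<Longrightarrow> f i = f j"
  shows "f i = f j"
proof -
  have "f (m, n) = f (0, 0)" for m n
  proof (rule lattice_connected[of "\<lambda>m n. f (m, n) = f (0, 0)" 0 0])
    fix m n
    show "f (m, n) = f (0, 0) \<longleftrightarrow> f (m + 1, n) = f (0, 0)"
      using assms[of "(m, n)" "(m + 1, n)"] by (simp add: is_edge_def)
    show "f (m, n) = f (0, 0) \<longleftrightarrow> f (m, n + 1) = f (0, 0)"
      using assms[of "(m, n)" "(m, n + 1)"] by (simp add: is_edge_def)
  qed (rule refl)
  thus ?thesis by (metis surj_pair)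
qed

lemma coplanar_if_directions:
  assumes U: "subspace U" "dim U \<le> 2" and A: "\<And>x. x \<in> A \<Longrightarrow> x - p \<in> U"
  shows "coplanar (A :: 'a :: euclidean_space set)"
proof -
  obtain B where B: "B \<subseteq> U" "independent B" "U \<subseteq> span B" "card B = dim U"
    using basis_exists by blast
  have fin: "finite B" using B(2) independent_imp_finite by blast
  \<comment> \<open>A basis with fewer than two elements is padded to a pair, since
    \<open>coplanar\<close> asks for three points spanning a containing affine hull.\<close>
  obtain u v where uv: "B \<subseteq> {u, v}"
  proof -
    consider "card B = 0" | "card B = 1" | "card B = 2" using B(4) U(2) by linarith
    thus thesis
      by cases (use that fin in \<open>auto simp: card_1_singleton_iff card_2_iff\<close>)
  qed
  have "x \<in> affine hull {p, p + u, p + v}" if "x \<in> A" for x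
  proof -
    have "x - p \<in> span {u, v}" using A[OF that] B(3) span_mono[OF uv] by blast
    then obtain c d where "x - p = c *\<^sub>R u + d *\<^sub>R v"
      by (auto simp: span_insert algebra_simps)
    hence "x = (1 - c - d) *\<^sub>R p + c *\<^sub>R (p + u) + d *\<^sub>R (p + v)"
      by (simp add: algebra_simps)
    moreover have "(1 - c - d) + c + d = 1" by simp
    ultimately show ?thesis unfolding affine_hull_3 by blast
  qed
  thus ?thesis unfolding coplanar_def by blast
qed

lemma conjugate_netI:
  assumes "\<And>i j k l. is_face i j k l \<Longrightarrow> \<exists>U. subspace U \<and> dim U \<le> 2 \<and>
    g j - g i \<in> U \<and> g k - g j \<in> U \<and> g l - g i \<in> U"
  shows "conjugate_net g"
  unfolding conjugate_net_def
proof (intro allI impI)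
  fix i j k l assume "is_face i j k l"
  from assms[OF this] obtain U where U: "subspace U" "dim U \<le> 2"
    and d: "g j - g i \<in> U" "g k - g j \<in> U" "g l - g i \<in> U" by blast
  have "g k - g i \<in> U" using subspace_add[OF U(1) d(1,2)] by simp
  thus "coplanar {g i, g j, g k, g l}"
    by (intro coplanar_if_directions[OF U, of _ "g i"]) (use d subspace_0[OF U(1)] in auto)
qed


section \<open>Lifts of Koenigs nets\<close>

locale koenigs_lift =
  fixes S :: "vertex \<Rightarrow> (real ^ 5) set"
    and q :: "real ^ 5"
    and s :: "vertex \<Rightarrow> real ^ 5"
  assumes koenigs: "koenigs_net S"
    and lift: "S i = span {s i}" "s i \<in> concentric_quadric q 1 0"
begin

lemma light: "mink (s i) (s i) = 0"
  and height: "mink (s i) q = 1" "mink q (s i) = 1"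
  using lift(2)[of i] by (auto simp: concentric_quadric_def mink_commute)

lemma eq_if_in_line:
  assumes "x \<in> span {y}" "x' \<in> span {y}" "mink x q = 1" "mink x' q = 1"
  shows "x = x'"
proof -
  obtain a b where "x = a *\<^sub>R y" "x' = b *\<^sub>R y"
    using assms(1,2) by (auto simp: span_singleton)
  with assms(3,4) show ?thesis
    by (auto simp: mink_scaleR_left) (metis mult_cancel_right zero_neq_one mult_zero_right)
qed

text \<open>If two opposite edges of the face collapsed, both diagonals would be the same projective
  line. Their intersection would then contain the distinct points \<open>s i\<close> and
  \<open>s k\<close> of height 1, so it would not be a single projective point.\<close>

lemma face_distinct:
  assumes f: "is_face i j k l"
  shows "s i \<noteq> s k" "s j \<noteq> s l" "\<not> (s i = s j \<and> s k = s l)" "\<not> (s j = s k \<and> s i = s l)"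
proof -
  have K: "S i \<noteq> S k" "S j \<noteq> S l" "diag_meet S i j k l \<in> proj_points"
    using koenigs f unfolding koenigs_net_def by blast+
  show ik: "s i \<noteq> s k" and "s j \<noteq> s l" using K lift by auto
  obtain y where y: "span (S i \<union> S k) \<inter> span (S j \<union> S l) = span {y}"
    using K(3) by (auto simp: diag_meet_def proj_points_def)
  have in_S: "s p \<in> S p" for p by (simp add: lift(1) span_base)
  have "\<not> S i \<union> S k = S j \<union> S l"
  proof
    assume "S i \<union> S k = S j \<union> S l"
    hence "s i \<in> span {y}" "s k \<in> span {y}"
      using y in_S span_base by (metis Int_absorb UnI1 UnI2)+
    from eq_if_in_line[OF this] height ik show False by simp
  qed
  thus "\<not> (s i = s j \<and> s k = s l)" "\<not> (s j = s k \<and> s i = s l)"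
    by (auto simp: lift(1))
qed

text \<open>Differences of points of height 1 are orthogonal to \<open>q\<close>. The intersection
  of the three-dimensional \<open>W\<close> with the orthogonal space of \<open>q\<close> misses
  \<open>s i\<close>, so its dimension is at most two.\<close>

lemma face_directions:
  assumes "is_face i j k l"
  obtains U where "subspace U" "dim U \<le> 2"
    "s j - s i \<in> U" "s k - s j \<in> U" "s l - s i \<in> U"
proof -
  have "proj_coplanar {S i, S j, S k, S l}"
    using koenigs assms unfolding koenigs_net_def proj_conjugate_net_def by blast
  then obtain W where W: "subspace W" "dim W = 3" "S i \<subseteq> W" "S j \<subseteq> W" "S k \<subseteq> W" "S l \<subseteq> W"
    unfolding proj_coplanar_def by auto
  have sW: "s i \<in> W" "s j \<in> W" "s k \<in> W" "s l \<in> W"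
    using W(3-) by (auto simp: lift(1) span_base subset_iff)
  define U where "U = W \<inter> {y. mink y q = 0}"
  have "subspace {y. mink y q = 0}"
    by (auto simp: subspace_def mink_simps)
  hence U: "subspace U" using W(1) by (simp add: U_def subspace_inter)
  have "s i \<notin> U" by (simp add: U_def height)
  hence "U \<subset> W" using sW(1) by (auto simp: U_def)
  hence "dim U < dim W" using dim_psubset[of U W] U W(1) by (simp add: span_eq_iff[THEN iffD2])
  with W(2) have "dim U \<le> 2" by simp
  with U show thesis
    by (rule that) (use sW in \<open>auto simp: U_def mink_simps height intro: subspace_diff[OF W(1)]\<close>)
qed

text \<open>Each face of \<open>g\<close> inherits the direction plane of the corresponding face of
  \<open>s\<close>. Applied both to \<open>s\<close> itself and to \<open>n + H s\<close>.\<close>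

lemma edge_parallel_conjugate_net:
  assumes "\<And>i j. is_edge i j \<Longrightarrow> \<exists>c. g j - g i = c *\<^sub>R (s j - s i)"
  shows "conjugate_net g"
proof (rule conjugate_netI)
  fix i j k l assume f: "is_face i j k l"
  obtain U where U: "subspace U" "dim U \<le> 2" "s j - s i \<in> U" "s k - s j \<in> U" "s l - s i \<in> U"
    using face_directions[OF f] by blast
  moreover have "g y - g x \<in> U" if "is_edge x y" "s y - s x \<in> U" for x y
    using assms[OF that(1)] subspace_scale[OF U(1) that(2)] by auto
  ultimately show "\<exists>U. subspace U \<and> dim U \<le> 2 \<and> g j - g i \<in> U \<and> g k - g j \<in> U \<and> g l - g i \<in> U"
    using is_face_edges[OF f] by blast
qed

lemma conjugate_net_lift: "conjugate_net s"
  by (rule edge_parallel_conjugate_net) (metis scaleR_one)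

text \<open>The vector \<open>n + k s\<close> is constant; it is unit and orthogonal to all
  \<open>s i\<close>, because \<open>s i\<close> is lightlike and orthogonal to \<open>n i\<close>.
  It represents the 2-sphere.\<close>

lemma totally_umbilic_imp_spherical:
  assumes n: "gauss_map q s n" and "totally_umbilic s n"
  shows "spherical_net s"
proof -
  obtain k where k: "\<And>i j. is_edge i j \<Longrightarrow> diff n i j + k *\<^sub>R diff s i j = 0"
    using assms(2) by (auto simp: totally_umbilic_def)
  define v where "v = n (0, 0) + k *\<^sub>R s (0, 0)"
  have step: "n i + k *\<^sub>R s i = n j + k *\<^sub>R s j" if "is_edge i j" for i j
    using k[OF that] by (simp add: diff_def algebra_simps)
  have v: "v = n i + k *\<^sub>R s i" for i
    unfolding v_def by (rule constant_if_edges_constant[OF step])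
  have n1: "mink (n i) (n i) = 1" "mink (n i) (s i) = 0" for i
    using n unfolding gauss_map_def tangent_space_def by blast+
  have "mink v v = 1"
    unfolding v_def using n1 light by (simp add: mink_simps mink_commute[of "s _" "n _"])
  moreover have "mink (s i) v = 0" for i
    using n1[of i] light[of i]
    by (simp add: v[of i] mink_simps mink_commute[of "s _" "n _"])
  ultimately show ?thesis unfolding spherical_net_def by (intro exI[of _ v]) simp
qed


subsection \<open>From a dual in a concentric quadric to the Gauss map\<close>

lemma joining_normal_of_dual:
  assumes nondegenerate: "\<exists>i j k l. is_face i j k l \<and> mixed_area s s i j k l \<noteq> 0"
    and dual: "koenigs_dual_in_concentric q s s'"
  shows "gauss_map q s (joining_normal q s s')"
    and "\<exists>H. mean_curvature_const s (joining_normal q s s') H"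
proof -
  obtain r t where rt: "\<And>i. mink (s' i) (s' i) = t" "\<And>i. mink (s' i) q = r"
    using dual by (auto simp: koenigs_dual_in_concentric_def concentric_quadric_def)
  have kd: "koenigs_dual s s'" using dual by (simp add: koenigs_dual_in_concentric_def)
  have edge: "\<exists>c. c \<noteq> 0 \<and> diff s' i j = c *\<^sub>R diff s i j" if "is_edge i j" for i j
    using kd that unfolding koenigs_dual_def by blast+
  have area: "wedge (diff s' i k) (diff s j l) = 0" "wedge (diff s i k) (diff s' j l) = 0"
    if "is_face i j k l" for i j k l
    using kd that unfolding koenigs_dual_def by blast+
  define b where "b = mink (s' (0, 0)) (s (0, 0))"
  have step: "mink (s' i) (s i) = mink (s' j) (s j)" if e: "is_edge i j" for i j
  proof -
    obtain c where c: "c \<noteq> 0" "s' j - s' i = c *\<^sub>R (s j - s i)"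
      using edge[OF e] by (auto simp: diff_def)
    have "mink (s' j - s' i) (s' i + s' j) = 0"
      by (simp add: mink_simps rt mink_commute[of "s' j" "s' i"])
    hence 1: "mink (s j - s i) (s' i + s' j) = 0" using c by (simp add: mink_scaleR_left)
    have "mink (s' j - s' i) (s i + s j) = c * mink (s j - s i) (s i + s j)"
      by (simp only: c mink_scaleR_left)
    hence 2: "mink (s' j - s' i) (s i + s j) = 0"
      by (simp add: mink_simps light mink_commute[of "s j" "s i"])
    \<comment> \<open>In the sum of the two equations the mixed terms cancel, leaving twice the
      change of \<open>(s',s)\<close> along the edge.\<close>
    from 1 2 show ?thesis
      by (simp add: mink_simps mink_commute[of "s _" "s' _"])
  qed
  have b: "mink (s' i) (s i) = b" for i
    unfolding b_def by (rule constant_if_edges_constant[OF step])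
  \<comment> \<open>The coefficients of \<open>s i\<close> and \<open>q\<close> in \<open>w\<close>
    are determined by \<open>(w,s) = (w,q) = 0\<close>. Since \<open>w\<close> differs from
    \<open>s' - s\<close> by a combination of \<open>s\<close> and \<open>q\<close>, it is the
    tangential projection.\<close>
  define \<rho> where "\<rho> = r - b * mink q q"
  define w where "w i = s' i - \<rho> *\<^sub>R s i - b *\<^sub>R q" for i
  have wT: "w i \<in> tangent_space q (s i)" for i
    by (simp add: tangent_space_def w_def mink_simps rt b light height \<rho>_def)
  have proj: "mink_proj (tangent_space q (s i)) (s' i - s i) = w i" for i
  proof (rule mink_proj_eqI[OF light height(1) wT])
    fix u assume "u \<in> tangent_space q (s i)"
    thus "mink (s' i - s i - w i) u = 0"
      by (simp add: w_def mink_simps tangent_space_def mink_commute[of _ u])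
  qed
  define \<tau> where "\<tau> = t - \<rho> * b - b * r"
  have ww: "mink (w i) (w i) = \<tau>" for i
  proof -
    have "mink (w i) (w i) = mink (w i) (s' i)"
      using wT[of i] by (subst (2) w_def) (simp add: tangent_space_def mink_simps)
    also have "\<dots> = \<tau>"
      by (simp add: w_def mink_simps rt b mink_commute[of "s _" "s' _"] mink_commute[of q "s' _"] \<tau>_def)
    finally show ?thesis .
  qed
  have diff_w: "diff w i j = diff s' i j - \<rho> *\<^sub>R diff s i j" for i j
    by (simp add: diff_def w_def algebra_simps)
  \<comment> \<open>The term \<open>b q\<close> is constant and drops out of differences, while
    \<open>s'\<close> has vanishing mixed area with \<open>s\<close>.\<close>
  have area_w: "mixed_area w s i j k l = - \<rho> *\<^sub>R mixed_area s s i j k l"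
    if "is_face i j k l" for i j k l
    using area[OF that]
    by (simp add: mixed_area_def diff_w wedge_def vec_eq_iff algebra_simps)
  \<comment> \<open>Otherwise \<open>w\<close> vanishes and \<open>s' = \<rho> s + b q\<close>. A
    face with nonzero area then gives \<open>\<rho> = 0\<close>, so \<open>s'\<close> is constant,
    against the nonzero edge factors of a dual.\<close>
  have "\<tau> \<noteq> 0"
  proof
    assume "\<tau> = 0"
    hence w0: "w i = 0" for i using mink_tangent_pos(2)[OF light height(1) wT] ww by metis
    obtain i j k l where f: "is_face i j k l" and ne: "mixed_area s s i j k l \<noteq> 0"
      using nondegenerate by blast
    have "\<rho> = 0" using area_w[OF f] ne by (simp add: mixed_area_def diff_def w0)
    hence const: "diff s' i j = 0" for i j using diff_w[of i j] w0 by (simp add: diff_def)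
    have "s i = s j" if "is_edge i j" for i j
      using edge[OF that] unfolding const by (auto simp: diff_def)
    with is_face_edges[OF f] have "s i = s k" by metis
    with face_distinct(1)[OF f] show False by simp
  qed
  moreover have "\<tau> \<ge> 0"
    using mink_tangent_pos(1)[OF light height(1) wT] ww by metis
  ultimately have \<tau>: "\<tau> > 0" by simp
  define \<mu> where "\<mu> = 1 / sqrt \<tau>"
  have \<mu>: "\<mu> * (\<mu> * \<tau>) = 1" using \<tau> by (simp add: \<mu>_def)
  have n: "joining_normal q s s' i = \<mu> *\<^sub>R w i" for i
    by (simp add: joining_normal_def proj mink_normalize_def ww \<mu>_def)
  have diff_n: "diff (joining_normal q s s') i j = \<mu> *\<^sub>R diff w i j" for i j
    by (simp add: diff_def n algebra_simps)
  show "gauss_map q s (joining_normal q s s')"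
    unfolding gauss_map_def
  proof (intro conjI allI impI)
    fix i
    show "mink (joining_normal q s s' i) (joining_normal q s s' i) = 1"
      using \<mu> by (simp add: n mink_simps ww)
    show "joining_normal q s s' i \<in> tangent_space q (s i)"
      using wT[of i] by (simp add: n tangent_space_def mink_simps)
  next
    fix i j assume "is_edge i j"
    then obtain c where "diff s' i j = c *\<^sub>R diff s i j" using edge by blast
    hence "diff (joining_normal q s s') i j + (\<mu> * (\<rho> - c)) *\<^sub>R diff s i j = 0"
      by (simp add: diff_n diff_w algebra_simps)
    thus "\<exists>k. diff (joining_normal q s s') i j + k *\<^sub>R diff s i j = 0" ..
  qed
  have "mean_curvature_const s (joining_normal q s s') (\<mu> * \<rho>)"
    unfolding mean_curvature_const_def
  proof (intro allI impI)
    fix i j k l assume f: "is_face i j k l"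
    have "mixed_area (joining_normal q s s') s i j k l = \<mu> *\<^sub>R mixed_area w s i j k l"
      by (simp add: mixed_area_def diff_n wedge_scaleR_left wedge_scaleR_right algebra_simps)
    thus "mixed_area (joining_normal q s s') s i j k l = - (\<mu> * \<rho>) *\<^sub>R mixed_area s s i j k l"
      by (simp add: area_w[OF f])
  qed
  thus "\<exists>H. mean_curvature_const s (joining_normal q s s') H" ..
qed


subsection \<open>From the Gauss map to a dual in a concentric quadric\<close>

text \<open>A collapsed edge collapses its faces, and neighbouring faces share an edge, so the
  collapse spreads over the connected lattice.\<close>

lemma collapsed_edge_collapses_net:
  assumes edge: "\<And>i j. is_edge i j \<Longrightarrow> \<exists>c. g j - g i = c *\<^sub>R (s j - s i)"
    and area: "\<And>i j k l. is_face i j k l \<Longrightarrow>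
      wedge (g k - g i) (s l - s j) = 0 \<and> wedge (s k - s i) (g l - g j) = 0"
    and "is_edge a b" "g a = g b" "is_edge i j"
  shows "g i = g j"
proof -
  have face: "(g i = g j \<or> g j = g k \<or> g k = g l \<or> g l = g i) \<longrightarrow>
      g i = g j \<and> g j = g k \<and> g k = g l"
    if f: "is_face i j k l" for i j k l
  proof -
    note e = is_face_edges[OF f]
    note W = area[OF f]
    have edge': "\<exists>c. g x - g y = c *\<^sub>R (s x - s y)" if "is_edge x y" for x y
      using edge[OF that] by (metis minus_diff_eq scaleR_minus_right)
    obtain c1 c2 c3 c4 where c: "g j - g i = c1 *\<^sub>R (s j - s i)" "g k - g j = c2 *\<^sub>R (s k - s j)"
      "g l - g k = c3 *\<^sub>R (s l - s k)" "g i - g l = c4 *\<^sub>R (s i - s l)"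
      using edge[OF e(1)] edge[OF e(2)] edge'[OF e(3)] edge'[OF e(4)] by blast
    \<comment> \<open>Sign and order variants of the diagonal conditions, as required by the four
      cyclic relabellings of the face below.\<close>
    have W': "wedge (g i - g k) (s l - s j) = 0" "wedge (g k - g i) (s j - s l) = 0"
      "wedge (g i - g k) (s j - s l) = 0" "wedge (s i - s k) (g l - g j) = 0"
      "wedge (s k - s i) (g j - g l) = 0" "wedge (s i - s k) (g j - g l) = 0"
      "wedge (g l - g j) (s i - s k) = 0" "wedge (g j - g l) (s k - s i) = 0"
      "wedge (s l - s j) (g i - g k) = 0" "wedge (s j - s l) (g k - g i) = 0"
      using W by (auto simp: wedge_def vec_eq_iff algebra_simps)
    note D = face_distinct[OF f]
    have 1: "g j = g k \<and> g k = g l" if "g i = g j"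
      by (rule collapsed_edge_collapses_face[OF lift(2) lift(2) lift(2) lift(2) _ _ _ c(1,2,3,4)])
        (use that D W W' in auto)
    have 2: "g k = g l \<and> g l = g i" if "g j = g k"
      by (rule collapsed_edge_collapses_face[OF lift(2) lift(2) lift(2) lift(2) _ _ _ c(2,3,4,1)])
        (use that D W W' in auto)
    have 3: "g l = g i \<and> g i = g j" if "g k = g l"
      by (rule collapsed_edge_collapses_face[OF lift(2) lift(2) lift(2) lift(2) _ _ _ c(3,4,1,2)])
        (use that D W W' in auto)
    have 4: "g i = g j \<and> g j = g k" if "g l = g i"
      by (rule collapsed_edge_collapses_face[OF lift(2) lift(2) lift(2) lift(2) _ _ _ c(4,1,2,3)])
        (use that D W W' in auto)
    show ?thesis using 1 2 3 4 by metis
  qed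
  \<comment> \<open>\<open>Z m n\<close> expresses that the face with lower left corner
    \<open>(m, n)\<close> is collapsed by \<open>g\<close>.\<close>
  define Z where "Z m n \<longleftrightarrow> g (m, n) = g (m + 1, n) \<and> g (m + 1, n) = g (m + 1, n + 1) \<and>
    g (m + 1, n + 1) = g (m, n + 1)" for m n
  have Z: "g (m, n) = g (m + 1, n) \<or> g (m + 1, n) = g (m + 1, n + 1) \<or>
      g (m + 1, n + 1) = g (m, n + 1) \<or> g (m, n + 1) = g (m, n) \<Longrightarrow> Z m n" for m n
    using face[of "(m, n)" "(m + 1, n)" "(m + 1, n + 1)" "(m, n + 1)"]
    unfolding Z_def is_face_def by blast
  obtain a1 a2 where "a = (a1, a2)" "b = (a1 + 1, a2) \<or> b = (a1, a2 + 1)"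
    using \<open>is_edge a b\<close> by (auto simp: is_edge_def)
  hence "Z a1 a2" using \<open>g a = g b\<close> by (intro Z) auto
  moreover have "Z m n \<longleftrightarrow> Z (m + 1) n" for m n
    by (rule iffI; rule Z) (auto simp: Z_def)
  moreover have "Z m n \<longleftrightarrow> Z m (n + 1)" for m n
    by (rule iffI; rule Z) (auto simp: Z_def)
  ultimately have all: "Z m n" for m n by (rule lattice_connected)
  obtain m n where "i = (m, n)" "j = (m + 1, n) \<or> j = (m, n + 1)"
    using \<open>is_edge i j\<close> by (auto simp: is_edge_def)
  with all[of m n] show ?thesis by (auto simp: Z_def)
qed

lemma dual_of_gauss_map:
  assumes n: "gauss_map q s n" and H: "mean_curvature_const s n H" and "\<not> totally_umbilic s n"
  shows "koenigs_dual_in_concentric q s (\<lambda>i. n i + H *\<^sub>R s i)"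
    and "n = joining_normal q s (\<lambda>i. n i + H *\<^sub>R s i)"
proof -
  define g where "g = (\<lambda>i. n i + H *\<^sub>R s i)"
  have n1: "mink (n i) (n i) = 1" "mink (n i) (s i) = 0" "mink (n i) q = 0"
    "n i \<in> tangent_space q (s i)" for i
    using n unfolding gauss_map_def tangent_space_def by blast+
  have diff_g: "diff g i j = diff n i j + H *\<^sub>R diff s i j" for i j
    by (simp add: g_def diff_def algebra_simps)
  have edge: "\<exists>c. g j - g i = c *\<^sub>R (s j - s i)" if e: "is_edge i j" for i j
  proof -
    obtain k where "diff n i j + k *\<^sub>R diff s i j = 0"
      using n e unfolding gauss_map_def by blast
    hence "diff n i j = - k *\<^sub>R diff s i j" by (simp add: eq_neg_iff_add_eq_0)
    hence "diff g i j = (H - k) *\<^sub>R diff s i j" by (simp add: diff_g algebra_simps)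
    thus ?thesis by (auto simp: diff_def)
  qed
  have wedge0: "wedge (g k - g i) (s l - s j) = 0 \<and> wedge (s k - s i) (g l - g j) = 0"
    if f: "is_face i j k l" for i j k l
  proof -
    have par: "wedge (s y - s x) (g y - g x) = 0" "wedge (s x - s y) (g x - g y) = 0"
      if e: "is_edge x y" for x y
    proof -
      show 1: "wedge (s y - s x) (g y - g x) = 0"
        using edge[OF e] by (auto simp: wedge_scaleR_right wedge_self)
      have "wedge (s x - s y) (g x - g y) = wedge (s y - s x) (g y - g x)"
        by (simp add: wedge_def vec_eq_iff algebra_simps)
      with 1 show "wedge (s x - s y) (g x - g y) = 0" by simp
    qed
    note e = is_face_edges[OF f]
    \<comment> \<open>Equality of the two wedges turns the single equation \<open>A(g,s) = 0\<close>
      into both parallelism conditions on diagonals.\<close>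
    have 1: "wedge (s k - s i) (g l - g j) = wedge (g k - g i) (s l - s j)"
      by (rule edge_parallel_wedge_diagonals) (use par e in blast)+
    have "mixed_area g s i j k l = mixed_area n s i j k l + H *\<^sub>R mixed_area s s i j k l"
      by (simp add: mixed_area_def diff_g wedge_def vec_eq_iff algebra_simps)
    also have "\<dots> = 0"
      using H f unfolding mean_curvature_const_def by (metis add.left_inverse scaleR_minus_left)
    finally have "wedge (g k - g i) (s l - s j) + wedge (s k - s i) (g l - g j) = 0"
      by (simp add: mixed_area_def diff_def)
    with 1 show ?thesis by (simp add: scaleR_2[symmetric])
  qed
  \<comment> \<open>One vanishing edge would make all edges of \<open>g\<close> vanish, and then
    \<open>n\<close> would be totally umbilic with \<open>k = H\<close>.\<close>
  have ne: "g i \<noteq> g j" if e: "is_edge i j" for i j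
  proof
    assume "g i = g j"
    from collapsed_edge_collapses_net[OF edge wedge0 e this]
    have "diff g x y = 0" if "is_edge x y" for x y using that by (auto simp: diff_def)
    with \<open>\<not> totally_umbilic s n\<close> show False unfolding totally_umbilic_def diff_g by blast
  qed
  have "\<exists>c. c \<noteq> 0 \<and> diff g i j = c *\<^sub>R diff s i j" if e: "is_edge i j" for i j
  proof -
    obtain c where c: "g j - g i = c *\<^sub>R (s j - s i)" using edge[OF e] by blast
    with ne[OF e] have "c \<noteq> 0" by auto
    with c show ?thesis unfolding diff_def by blast
  qed
  moreover have "conjugate_net g" by (rule edge_parallel_conjugate_net[OF edge])
  ultimately have "koenigs_dual s g"
    using conjugate_net_lift wedge0 unfolding koenigs_dual_def diff_def by blast
  \<comment> \<open>Both \<open>(g,q) = H\<close> and \<open>(g,g) = 1\<close> follow because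
    \<open>n\<close> is a unit vector orthogonal to \<open>s\<close> and \<open>q\<close>, and
    \<open>s\<close> is lightlike of height 1.\<close>
  moreover have "g i \<in> concentric_quadric q H 1" for i
    using n1[of i] light[of i] height[of i]
    by (simp add: g_def concentric_quadric_def mink_simps mink_commute[of "s i" "n i"])
  ultimately have "koenigs_dual_in_concentric q s g"
    unfolding koenigs_dual_in_concentric_def by blast
  thus "koenigs_dual_in_concentric q s (\<lambda>i. n i + H *\<^sub>R s i)"
    by (simp only: g_def)
  \<comment> \<open>The joining field is \<open>n + (H - 1) s\<close>, and \<open>s i\<close> is
    orthogonal to its tangent space. The projection is therefore \<open>n i\<close>, already of unit
    length.\<close>
  have proj: "mink_proj (tangent_space q (s i)) (n i + H *\<^sub>R s i - s i) = n i" for i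
  proof (rule mink_proj_eqI[OF light height(1) n1(4)])
    fix u assume "u \<in> tangent_space q (s i)"
    hence "mink (s i) u = 0" by (simp add: tangent_space_def mink_commute[of _ u])
    thus "mink (n i + H *\<^sub>R s i - s i - n i) u = 0" by (simp add: mink_simps)
  qed
  show "n = joining_normal q s (\<lambda>i. n i + H *\<^sub>R s i)"
    unfolding joining_normal_def proj by (rule ext) (simp only: mink_normalize_unit n1(1))
qed

end

text \<open>Spherical nets are set apart in the equivalence because a totally umbilic Gauss map
  makes a parallel net \<open>n + k s\<close> constant, which is not a Koenigs dual. For all other
  Gauss maps of constant mean curvature, \<open>n + H s\<close> is the dual sought.\<close>

theorem mainTheorem3:
  fixes S :: "vertex \<Rightarrow> (real ^ 5) set"
    and q :: "real ^ 5"
    and s :: "vertex \<Rightarrow> real ^ 5"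
  assumes koenigs: "koenigs_net S"
    and quadric: "\<forall>i. S i \<in> moebius_quadric"
    and q: "q \<noteq> 0"
    and lift: "\<forall>i. S i = span {s i} \<and> s i \<in> concentric_quadric q 1 0"
    and nondegenerate: "\<exists>i j k l. is_face i j k l \<and> mixed_area s s i j k l \<noteq> 0"
  shows "(\<not> spherical_net s \<longrightarrow>
            (cmc_net q s \<longleftrightarrow> (\<exists>s'. koenigs_dual_in_concentric q s s'))) \<and>
         ((\<exists>s'. koenigs_dual_in_concentric q s s') \<longrightarrow> cmc_net q s) \<and>
         (\<forall>s'. koenigs_dual_in_concentric q s s' \<longrightarrow>
            gauss_map q s (joining_normal q s s') \<and>
            (\<exists>H. mean_curvature_const s (joining_normal q s s') H)) \<and>
         (\<forall>n H. gauss_map q s n \<and> mean_curvature_const s n H \<and> \<not> totally_umbilic s n \<longrightarrow>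
            (\<exists>s'. koenigs_dual_in_concentric q s s' \<and> n = joining_normal q s s'))"
proof -
  interpret koenigs_lift S q s
    by unfold_locales (use koenigs lift in blast)+
  note to_normal = joining_normal_of_dual[OF nondegenerate]
  have to_cmc: "cmc_net q s" if "koenigs_dual_in_concentric q s s'" for s'
    using to_normal[OF that] unfolding cmc_net_def by blast
  have from_cmc: "\<exists>s'. koenigs_dual_in_concentric q s s'"
    if ns: "\<not> spherical_net s" and "cmc_net q s"
  proof -
    obtain n H where n: "gauss_map q s n" "mean_curvature_const s n H"
      using \<open>cmc_net q s\<close> unfolding cmc_net_def by blast
    moreover have "\<not> totally_umbilic s n"
      using ns totally_umbilic_imp_spherical[OF n(1)] by blast
    ultimately have "koenigs_dual_in_concentric q s (\<lambda>i. n i + H *\<^sub>R s i)"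
      by (rule dual_of_gauss_map(1))
    thus ?thesis by blast
  qed
  show ?thesis
  proof (intro conjI impI allI)
    fix n H assume n: "gauss_map q s n \<and> mean_curvature_const s n H \<and> \<not> totally_umbilic s n"
    show "\<exists>s'. koenigs_dual_in_concentric q s s' \<and> n = joining_normal q s s'"
      using n dual_of_gauss_map[of n H] by (intro exI[of _ "\<lambda>i. n i + H *\<^sub>R s i"]) blast
  qed (use to_cmc from_cmc to_normal in blast)+
qed

end
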